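(* For topological groups $G$ and $H$, the following conditions are equivalent: (1) the topological group $G\times H$ is $\mathbb R$-factorizable; (2) the groups $G$ and $H$ are $\mathbb R$-factorizable and the product $G\times H$ is multiplicatively $\mathbb R$-factorizable.
   Context: All topological spaces and topological groups are assumed to be Tychonoff (including Hausdorff). A topological group $G$ is $\mathbb R$-factorizable if for any continuous function $f\colon G\to\mathbb R$ there exist a second-countable topological group $H$, a continuous homomorphism $h\colon G\to H$, and a continuous function $g\colon H\to\mathbb R$ such that $f=g\circ h$. A product $X\times Y$ of topological spaces is (multiplicatively) $\mathbb R$-factorizable if for any continuous function $f\colon X\times Y\to\mathbb R$ there exist second-countable spaces $X',Y'$ and continuous maps $g_1\colon X\to X'$, $g_2\colon Y\to Y'$, and $h\colon X'\times Y'\to\mathbb R$ such that $f=h\circ(g_1\times g_2)$. *)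

theory Defs
  imports "HOL-Analysis.Analysis" "HOL-Algebra.Group"
begin

definition Tychonoff_space :: "'a topology \<Rightarrow> bool" where
  "Tychonoff_space X \<longleftrightarrow> completely_regular_space X \<and> Hausdorff_space X"

locale topological_group = group G for G (structure) +
  fixes T :: "'a topology"
  assumes topspace_eq_carrier: "topspace T = carrier G"
    and continuous_mult: "continuous_map (prod_topology T T) T (\<lambda>(x, y). x \<otimes> y)"
    and continuous_inv: "continuous_map T T (\<lambda>x. inv x)"
    and Tychonoff: "Tychonoff_space T"

text \<open>
  HOL cannot quantify existentially over types, so the second-countable groups and spaces in the
  two definitions below live on subsets of the type of reals. This is no restriction: a
  second-countable Hausdorff space has at most continuum many points, and its topology (and group
  structure) can be transported to a set of reals. The lemmas \<open>R_factorizable_groupI\<close> and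
  \<open>R_factorizable_productI\<close> show that witnesses over arbitrary types suffice.
\<close>

definition R_factorizable_group :: "('a, 'm) monoid_scheme \<Rightarrow> 'a topology \<Rightarrow> bool" where
  "R_factorizable_group G T \<longleftrightarrow>
     (\<forall>f. continuous_map T euclideanreal f \<longrightarrow>
        (\<exists>(K :: real monoid) U h g.
           topological_group K U \<and> second_countable U \<and>
           h \<in> hom G K \<and> continuous_map T U h \<and>
           continuous_map U euclideanreal g \<and>
           (\<forall>x\<in>topspace T. f x = g (h x))))"

definition R_factorizable_product :: "'a topology \<Rightarrow> 'b topology \<Rightarrow> bool" where
  "R_factorizable_product X Y \<longleftrightarrow>
     (\<forall>f. continuous_map (prod_topology X Y) euclideanreal f \<longrightarrow>
        (\<exists>(X' :: real topology) (Y' :: real topology) g1 g2 h.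
           Tychonoff_space X' \<and> second_countable X' \<and>
           Tychonoff_space Y' \<and> second_countable Y' \<and>
           continuous_map X X' g1 \<and> continuous_map Y Y' g2 \<and>
           continuous_map (prod_topology X' Y') euclideanreal h \<and>
           (\<forall>x\<in>topspace X. \<forall>y\<in>topspace Y. f (x, y) = h (g1 x, g2 y))))"

lemma Tychonoff_space_homeomorphic:
  assumes "X homeomorphic_space Y" "Tychonoff_space X"
  shows "Tychonoff_space Y"
  using assms homeomorphic_Hausdorff_space homeomorphic_completely_regular_space
  unfolding Tychonoff_space_def by blast

lemma second_countable_Hausdorff_inj_real:
  fixes X :: "'b topology"
  assumes "second_countable X" "Hausdorff_space X"
  obtains j :: "'b \<Rightarrow> real" where "inj_on j (topspace X)"
proof -
  obtain B where B: "countable B" "\<And>V. V \<in> B \<Longrightarrow> openin X V"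
    "\<And>U x. openin X U \<Longrightarrow> x \<in> U \<Longrightarrow> \<exists>V\<in>B. x \<in> V \<and> V \<subseteq> U"
    using assms(1) unfolding second_countable_def by metis
  define c where "c x = to_nat_on B ` {V \<in> B. x \<in> V}" for x
  have "inj_on c (topspace X)"
  proof (rule inj_onI, rule ccontr)
    fix x y assume xy: "x \<in> topspace X" "y \<in> topspace X" "c x = c y" "x \<noteq> y"
    then obtain U where U: "openin X U" "x \<in> U" "y \<notin> U"
      using assms(2) unfolding Hausdorff_space_def disjnt_iff by metis
    then obtain W where W: "W \<in> B" "x \<in> W" "y \<notin> W" using B(3) by blast
    then have "to_nat_on B W \<in> c y" using xy(3) unfolding c_def by blast
    then obtain W' where "W' \<in> B" "y \<in> W'" "to_nat_on B W = to_nat_on B W'"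
      unfolding c_def by blast
    with W inj_onD[OF inj_on_to_nat_on[OF B(1)]] show False by blast
  qed
  moreover obtain r :: "nat set \<Rightarrow> real" where "inj r"
    using nat_sets_eqpoll_reals bij_betw_imp_inj_on unfolding eqpoll_def by metis
  ultimately have "inj_on (r \<circ> c) (topspace X)"
    by (blast intro: comp_inj_on inj_on_subset)
  then show ?thesis using that by blast
qed

lemma homeomorphic_copy:
  fixes X :: "'b topology" and j :: "'b \<Rightarrow> 'c"
  assumes "inj_on j (topspace X)"
  obtains X' i where "homeomorphic_maps X X' j i" "topspace X' = j ` topspace X"
proof -
  define i where "i = inv_into (topspace X) j"
  define X' where "X' = pullback_topology (j ` topspace X) i X"
  have ij: "\<And>x. x \<in> topspace X \<Longrightarrow> i (j x) = x"
    using assms by (simp add: i_def)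
  have top: "topspace X' = j ` topspace X"
    unfolding X'_def topspace_pullback_topology using ij by auto
  have "continuous_map X X' j"
    unfolding X'_def
    by (rule continuous_map_pullback')
       (auto intro: continuous_map_eq[OF continuous_map_id] simp: ij)
  moreover have "continuous_map X' X i"
    unfolding X'_def using continuous_map_pullback[OF continuous_map_id, of "j ` topspace X" i X]
    by (simp add: o_def)
  ultimately have "homeomorphic_maps X X' j i"
    unfolding homeomorphic_maps_def using ij top by auto
  then show ?thesis using top that by blast
qed

lemma second_countable_space_real_copy:
  fixes X :: "'b topology"
  assumes "second_countable X" "Tychonoff_space X"
  obtains X' :: "real topology" and j i where "homeomorphic_maps X X' j i"
    "second_countable X'" "Tychonoff_space X'"
proof -
  obtain j :: "'b \<Rightarrow> real" where "inj_on j (topspace X)"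
    using assms second_countable_Hausdorff_inj_real unfolding Tychonoff_space_def by blast
  then obtain X' i where hm: "homeomorphic_maps X X' j i"
    using homeomorphic_copy by metis
  then have "X homeomorphic_space X'"
    unfolding homeomorphic_space_def by blast
  then show ?thesis
    using that hm assms Tychonoff_space_homeomorphic homeomorphic_space_second_countability
    by blast
qed

lemma (in topological_group) topological_group_copy:
  fixes j :: "'a \<Rightarrow> 'c"
  assumes hm: "homeomorphic_maps T U j i"
  obtains K :: "'c monoid" where "topological_group K U" "j \<in> hom G K"
proof -
  define K where "K = \<lparr>carrier = topspace U, mult = (\<lambda>x y. j (i x \<otimes> i y)), one = j \<one>\<rparr>"
  have cj: "continuous_map T U j" and ci: "continuous_map U T i"
    and ij: "\<And>x. x \<in> carrier G \<Longrightarrow> i (j x) = x"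
    and ji: "\<And>y. y \<in> topspace U \<Longrightarrow> j (i y) = y"
    using hm topspace_eq_carrier unfolding homeomorphic_maps_def by auto
  have j: "\<And>x. x \<in> carrier G \<Longrightarrow> j x \<in> topspace U"
    and i: "\<And>y. y \<in> topspace U \<Longrightarrow> i y \<in> carrier G"
    using cj ci topspace_eq_carrier unfolding continuous_map_def by auto
  have K: "group K"
  proof (rule groupI)
    show "\<exists>y\<in>carrier K. y \<otimes>\<^bsub>K\<^esub> x = \<one>\<^bsub>K\<^esub>" if "x \<in> carrier K" for x
      using that by (intro bexI[of _ "j (inv (i x))"]) (auto simp: K_def i j ij)
  qed (auto simp: K_def i j ij ji m_assoc)
  have inv_K: "inv\<^bsub>K\<^esub> x = j (inv (i x))" if "x \<in> topspace U" for x
    using that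
    by (intro group.inv_equality[OF K]) (auto simp: K_def i j ij)
  have "continuous_map (prod_topology U U) (prod_topology T T) (\<lambda>p. (i (fst p), i (snd p)))"
    unfolding continuous_map_pairwise o_def fst_conv snd_conv
    using continuous_map_compose[OF continuous_map_fst ci, unfolded o_def]
      continuous_map_compose[OF continuous_map_snd ci, unfolded o_def] by (rule conjI)
  from continuous_map_compose[OF continuous_map_compose[OF this continuous_mult] cj]
  have "continuous_map (prod_topology U U) U (\<lambda>(x, y). x \<otimes>\<^bsub>K\<^esub> y)"
    by (simp add: K_def o_def case_prod_unfold)
  moreover from continuous_map_compose[OF continuous_map_compose[OF ci continuous_inv] cj]
  have "continuous_map U U (\<lambda>x. inv\<^bsub>K\<^esub> x)"
    by (rule continuous_map_eq) (simp add: inv_K)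
  moreover have "Tychonoff_space U"
    using hm Tychonoff Tychonoff_space_homeomorphic unfolding homeomorphic_space_def by blast
  ultimately have "topological_group K U"
    using K by (simp add: topological_group_def topological_group_axioms_def K_def)
  moreover have "j \<in> hom G K"
    by (auto simp: hom_def K_def j ij)
  ultimately show ?thesis using that by blast
qed

lemma R_factorizable_groupI:
  fixes G :: "('a, 'm) monoid_scheme" and T :: "'a topology"
  assumes "\<And>f. continuous_map T euclideanreal f \<Longrightarrow>
        \<exists>(K :: ('b, 'n) monoid_scheme) U h g.
           topological_group K U \<and> second_countable U \<and>
           h \<in> hom G K \<and> continuous_map T U h \<and>
           continuous_map U euclideanreal g \<and>
           (\<forall>x\<in>topspace T. f x = g (h x))"
  shows "R_factorizable_group G T"
  unfolding R_factorizable_group_def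
proof (intro allI impI)
  fix f assume "continuous_map T euclideanreal f"
  from assms[OF this] obtain K :: "('b, 'n) monoid_scheme" and U h g where
    K: "topological_group K U" "second_countable U"
    and h: "h \<in> hom G K" "continuous_map T U h"
    and g: "continuous_map U euclideanreal g" "\<forall>x\<in>topspace T. f x = g (h x)"
    by blast
  obtain U' :: "real topology" and j i where
    hm: "homeomorphic_maps U U' j i" and U': "second_countable U'"
    using second_countable_space_real_copy[OF K(2) topological_group.Tychonoff[OF K(1)]] by blast
  obtain K' :: "real monoid" where K': "topological_group K' U'" "j \<in> hom K K'"
    using topological_group.topological_group_copy[OF K(1) hm] by blast
  have "j \<circ> h \<in> hom G K'"
    using hom_compose[OF h(1) K'(2)] .
  moreover have "continuous_map T U' (j \<circ> h)" "continuous_map U' euclideanreal (g \<circ> i)"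
    using hm continuous_map_compose[OF h(2), of U' j] continuous_map_compose[of U' U i, OF _ g(1)]
    unfolding homeomorphic_maps_def by simp_all
  moreover have "f x = (g \<circ> i) ((j \<circ> h) x)" if "x \<in> topspace T" for x
    using hm that g(2) h(2) unfolding homeomorphic_maps_def continuous_map_def Pi_iff by simp
  ultimately show "\<exists>(K :: real monoid) U h g.
           topological_group K U \<and> second_countable U \<and>
           h \<in> hom G K \<and> continuous_map T U h \<and>
           continuous_map U euclideanreal g \<and>
           (\<forall>x\<in>topspace T. f x = g (h x))"
    using K'(1) U' by (intro exI[of _ K'] exI[of _ U'] exI[of _ "j \<circ> h"] exI[of _ "g \<circ> i"]) simp
qed

lemma R_factorizable_productI:
  fixes X :: "'a topology" and Y :: "'b topology"
  assumes "\<And>f. continuous_map (prod_topology X Y) euclideanreal f \<Longrightarrow>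
        \<exists>(X' :: 'c topology) (Y' :: 'd topology) g1 g2 h.
           Tychonoff_space X' \<and> second_countable X' \<and>
           Tychonoff_space Y' \<and> second_countable Y' \<and>
           continuous_map X X' g1 \<and> continuous_map Y Y' g2 \<and>
           continuous_map (prod_topology X' Y') euclideanreal h \<and>
           (\<forall>x\<in>topspace X. \<forall>y\<in>topspace Y. f (x, y) = h (g1 x, g2 y))"
  shows "R_factorizable_product X Y"
  unfolding R_factorizable_product_def
proof (intro allI impI)
  fix f assume "continuous_map (prod_topology X Y) euclideanreal f"
  from assms[OF this] obtain X' :: "'c topology" and Y' :: "'d topology" and g1 g2 h where
    X': "second_countable X'" "Tychonoff_space X'"
    and Y': "second_countable Y'" "Tychonoff_space Y'"
    and g: "continuous_map X X' g1" "continuous_map Y Y' g2"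
    and h: "continuous_map (prod_topology X' Y') euclideanreal h"
      "\<forall>x\<in>topspace X. \<forall>y\<in>topspace Y. f (x, y) = h (g1 x, g2 y)"
    by blast
  obtain X'' :: "real topology" and j1 i1 where
    hm1: "homeomorphic_maps X' X'' j1 i1" and X'': "second_countable X''" "Tychonoff_space X''"
    using second_countable_space_real_copy[OF X'] by blast
  obtain Y'' :: "real topology" and j2 i2 where
    hm2: "homeomorphic_maps Y' Y'' j2 i2" and Y'': "second_countable Y''" "Tychonoff_space Y''"
    using second_countable_space_real_copy[OF Y'] by blast
  let ?i = "\<lambda>p. (i1 (fst p), i2 (snd p))"
  have i: "continuous_map X'' X' i1" "continuous_map Y'' Y' i2"
    using hm1 hm2 unfolding homeomorphic_maps_def by auto
  have "continuous_map (prod_topology X'' Y'') (prod_topology X' Y') ?i"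
    unfolding continuous_map_pairwise o_def fst_conv snd_conv
    using continuous_map_compose[OF continuous_map_fst i(1), unfolded o_def]
      continuous_map_compose[OF continuous_map_snd i(2), unfolded o_def] by (rule conjI)
  from continuous_map_compose[OF this h(1)]
  have "continuous_map (prod_topology X'' Y'') euclideanreal (h \<circ> ?i)" .
  moreover have "continuous_map X X'' (j1 \<circ> g1)" "continuous_map Y Y'' (j2 \<circ> g2)"
    using hm1 hm2 continuous_map_compose[OF g(1), of X'' j1] continuous_map_compose[OF g(2), of Y'' j2]
    unfolding homeomorphic_maps_def by simp_all
  moreover have "f (x, y) = (h \<circ> ?i) ((j1 \<circ> g1) x, (j2 \<circ> g2) y)"
    if "x \<in> topspace X" "y \<in> topspace Y" for x y
    using hm1 hm2 that g h(2) unfolding homeomorphic_maps_def continuous_map_def Pi_iff by simp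
  ultimately show "\<exists>(X' :: real topology) (Y' :: real topology) g1 g2 h.
           Tychonoff_space X' \<and> second_countable X' \<and>
           Tychonoff_space Y' \<and> second_countable Y' \<and>
           continuous_map X X' g1 \<and> continuous_map Y Y' g2 \<and>
           continuous_map (prod_topology X' Y') euclideanreal h \<and>
           (\<forall>x\<in>topspace X. \<forall>y\<in>topspace Y. f (x, y) = h (g1 x, g2 y))"
    using X'' Y''
    by (intro exI[of _ X''] exI[of _ Y''] exI[of _ "j1 \<circ> g1"] exI[of _ "j2 \<circ> g2"] exI[of _ "h \<circ> ?i"])
      simp
qed

end

theory Submission
  imports Defs "HOL-Algebra.Product_Groups"
begin

text \<open>
  If \<open>G \<times> H\<close> is \<open>\<real>\<close>-factorizable, then so are its retracts \<open>G\<close> and \<open>H\<close>; and if \<open>f = g \<circ> h\<close> with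
  \<open>h\<close> a homomorphism to a second-countable group, then \<open>h (x, y) = h (x, 1) h (1, y)\<close> factors \<open>f\<close>
  multiplicatively. Conversely, in an \<open>\<real>\<close>-factorizable group \<open>G\<close> every continuous map to a
  second-countable space \<open>X'\<close> factors through a continuous homomorphism to a second-countable
  group: the topology of \<open>X'\<close> is generated by countably many real functions, and each of them
  gives a homomorphism; take the image of the diagonal homomorphism into the product. Applied to
  both coordinate maps of a multiplicative factorization of \<open>f\<close>, this yields a homomorphic one.
\<close>

section \<open>Second-countable spaces\<close>

lemma second_countable_prod_topology:
  assumes "second_countable X" "second_countable Y"
  shows "second_countable (prod_topology X Y)"
proof -
  obtain B C where B: "countable B" "\<And>V. V \<in> B \<Longrightarrow> openin X V"
      "\<And>U x. openin X U \<Longrightarrow> x \<in> U \<Longrightarrow> \<exists>V\<in>B. x \<in> V \<and> V \<subseteq> U"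
    and C: "countable C" "\<And>V. V \<in> C \<Longrightarrow> openin Y V"
      "\<And>U x. openin Y U \<Longrightarrow> x \<in> U \<Longrightarrow> \<exists>V\<in>C. x \<in> V \<and> V \<subseteq> U"
    using assms unfolding second_countable_def by metis
  show ?thesis
    unfolding second_countable_def
  proof (intro exI[of _ "(\<lambda>(V, W). V \<times> W) ` (B \<times> C)"] conjI ballI allI impI)
    show "countable ((\<lambda>(V, W). V \<times> W) ` (B \<times> C))"
      using B(1) C(1) by blast
    show "openin (prod_topology X Y) V" if "V \<in> (\<lambda>(V, W). V \<times> W) ` (B \<times> C)" for V
      using that B(2) C(2) by (auto simp: openin_prod_Times_iff)
    fix U z assume "openin (prod_topology X Y) U \<and> z \<in> U"
    then obtain V W where "openin X V" "openin Y W" "fst z \<in> V" "snd z \<in> W" "V \<times> W \<subseteq> U"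
      unfolding openin_prod_topology_alt by (metis prod.collapse)
    moreover from this obtain V' W' where "V' \<in> B" "fst z \<in> V'" "V' \<subseteq> V" "W' \<in> C" "snd z \<in> W'" "W' \<subseteq> W"
      using B(3) C(3) by meson
    ultimately show "\<exists>V\<in>(\<lambda>(V, W). V \<times> W) ` (B \<times> C). z \<in> V \<and> V \<subseteq> U"
      by (intro bexI[of _ "V' \<times> W'"]) (auto simp: mem_Times_iff)
  qed
qed

lemma second_countable_product_topology:
  assumes I: "countable I" and X: "\<And>i. i \<in> I \<Longrightarrow> second_countable (X i)"
  shows "second_countable (product_topology X I)"
proof -
  have "\<exists>B. countable B \<and> (\<forall>V\<in>B. openin (X i) V) \<and>
      (\<forall>U x. openin (X i) U \<and> x \<in> U \<longrightarrow> (\<exists>V\<in>B. x \<in> V \<and> V \<subseteq> U))" if "i \<in> I" for i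
    using X[OF that] unfolding second_countable_def .
  then obtain B where "\<forall>i\<in>I. countable (B i) \<and> (\<forall>V\<in>B i. openin (X i) V) \<and>
      (\<forall>U x. openin (X i) U \<and> x \<in> U \<longrightarrow> (\<exists>V\<in>B i. x \<in> V \<and> V \<subseteq> U))"
    by (rule bchoice[OF ballI, THEN exE])
  then have B: "\<And>i. i \<in> I \<Longrightarrow> countable (B i)"
    "\<And>i V. i \<in> I \<Longrightarrow> V \<in> B i \<Longrightarrow> openin (X i) V"
    "\<And>i U x. i \<in> I \<Longrightarrow> openin (X i) U \<Longrightarrow> x \<in> U \<Longrightarrow> \<exists>V\<in>B i. x \<in> V \<and> V \<subseteq> U"
    by simp_all
  \<comment> \<open>A basic open box, constrained only at the coordinates in \<open>F\<close>. The
    countable set \<open>I\<close> has countably many finite subsets \<open>F\<close>, and each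
    leaves countably many choices in \<open>Pi\<^sub>E F B\<close>; hence \<open>D\<close> is
    countable.\<close>
  define box where "box F V = Pi\<^sub>E I (\<lambda>i. if i \<in> F then V i else topspace (X i))"
    for F :: "'a set" and V :: "'a \<Rightarrow> 'b set"
  define D where "D = (\<Union>F\<in>{F. finite F \<and> F \<subseteq> I}. box F ` Pi\<^sub>E F B)"
  show ?thesis
    unfolding second_countable_def
  proof (intro exI[of _ D] conjI ballI allI impI)
    have "countable (Pi\<^sub>E F B)" if "finite F \<and> F \<subseteq> I" for F
      using that B(1) by (intro countable_PiE) auto
    then show "countable D"
      unfolding D_def using countable_Collect_finite_subset[OF I]
      by (intro countable_UN countable_image) (auto simp: conj_commute)
    show "openin (product_topology X I) V" if "V \<in> D" for V
      using that B(2) unfolding D_def box_def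
      by (auto simp: openin_PiE_gen PiE_iff subset_iff elim: finite_subset[rotated])
    fix U x assume "openin (product_topology X I) U \<and> x \<in> U"
    then obtain W where W: "finite {i \<in> I. W i \<noteq> topspace (X i)}"
      "\<And>i. i \<in> I \<Longrightarrow> openin (X i) (W i)" "x \<in> Pi\<^sub>E I W" "Pi\<^sub>E I W \<subseteq> U"
      unfolding openin_product_topology_alt by metis
    \<comment> \<open>Only the finitely many coordinates where \<open>W\<close> is proper need a
      base member inside it; at all others the box keeps the whole factor, which is
      \<open>W i\<close> itself.\<close>
    define F where "F = {i \<in> I. W i \<noteq> topspace (X i)}"
    have "\<exists>V\<in>B i. x i \<in> V \<and> V \<subseteq> W i" if "i \<in> I" for i
      using B(3)[OF that W(2)[OF that]] W(3) that by blast
    then obtain V where V: "\<And>i. i \<in> I \<Longrightarrow> V i \<in> B i \<and> x i \<in> V i \<and> V i \<subseteq> W i"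
      by metis
    \<comment> \<open>Members of \<open>Pi\<^sub>E F B\<close> are undefined off \<open>F\<close>,
      hence the \<open>restrict\<close>; \<open>box F\<close> does not look at those values.\<close>
    have "box F (restrict V F) \<in> D"
      unfolding D_def using W(1) V by (auto simp: F_def)
    moreover have "x \<in> box F (restrict V F)"
      using V W(3) unfolding box_def by (auto simp: F_def PiE_iff)
    moreover have "box F (restrict V F) \<subseteq> Pi\<^sub>E I W"
      unfolding box_def using V by (intro PiE_mono) (simp add: F_def)
    ultimately show "\<exists>V\<in>D. x \<in> V \<and> V \<subseteq> U"
      using W(4) by (meson order_trans)
  qed
qed

text \<open>The cozero sets of the \<open>\<phi> n\<close> form a base. Countably many functions
  suffice because one is chosen for each pair \<open>V\<close>, \<open>W\<close> of base members
  that admits a continuous function nonzero throughout \<open>V\<close> and zero outside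
  \<open>W\<close>.\<close>

lemma second_countable_completely_regular_functions:
  assumes "second_countable X" "completely_regular_space X"
  obtains \<phi> :: "nat \<Rightarrow> 'a \<Rightarrow> real" where "\<And>n. continuous_map X euclideanreal (\<phi> n)"
    "\<And>U x. openin X U \<Longrightarrow> x \<in> U \<Longrightarrow> \<exists>n. \<phi> n x \<noteq> 0 \<and> {y \<in> topspace X. \<phi> n y \<noteq> 0} \<subseteq> U"
proof -
  obtain B where B: "countable B" "\<And>V. V \<in> B \<Longrightarrow> openin X V"
    "\<And>U x. openin X U \<Longrightarrow> x \<in> U \<Longrightarrow> \<exists>V\<in>B. x \<in> V \<and> V \<subseteq> U"
    using assms(1) unfolding second_countable_def by metis
  define P where "P V W f \<longleftrightarrow> continuous_map X euclideanreal f \<and> (\<forall>y\<in>V. f y \<noteq> 0) \<and>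
    {y \<in> topspace X. f y \<noteq> 0} \<subseteq> W" for V W :: "'a set" and f :: "'a \<Rightarrow> real"
  \<comment> \<open>Pairs without a separating function get the zero function, so that
    \<open>F V W\<close> is continuous in every case.\<close>
  define F where "F V W = (if \<exists>f. P V W f then SOME f. P V W f else (\<lambda>_. 0))" for V W
  \<comment> \<open>The inserted zero function keeps \<open>\<F>\<close> nonempty even when the base
    is empty, so that it can be enumerated by all of \<open>nat\<close>.\<close>
  define \<F> where "\<F> = insert (\<lambda>_. 0) ((\<lambda>(V, W). F V W) ` (B \<times> B))"
  have F: "P V W (F V W)" if "P V W f" for V W f
    using someI[of "P V W" f] that unfolding F_def by auto
  have "continuous_map X euclideanreal (F V W)" for V W
  proof (cases "\<exists>f. P V W f")
    case True
    then show ?thesis using F P_def by blast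
  qed (simp add: F_def)
  then have cont: "continuous_map X euclideanreal f" if "f \<in> \<F>" for f
    using that unfolding \<F>_def by auto
  have sep: "\<exists>f\<in>\<F>. f x \<noteq> 0 \<and> {y \<in> topspace X. f y \<noteq> 0} \<subseteq> U" if U: "openin X U" "x \<in> U" for U x
  proof -
    obtain W where W: "W \<in> B" "x \<in> W" "W \<subseteq> U" using B(3) U by blast
    have "closedin X (topspace X - W)" "x \<in> topspace X - (topspace X - W)"
      using B(2)[OF W(1)] W(2) openin_subset by blast+
    then obtain f where f: "continuous_map X (top_of_set {0..1::real}) f" "f x = 0"
      "f ` (topspace X - W) \<subseteq> {1}"
      using assms(2) unfolding completely_regular_space_def by metis
    \<comment> \<open>Complete regularity yields 0 at \<open>x\<close> and 1 off \<open>W\<close>;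
      flipping turns this into nonzero at \<open>x\<close> and zero off \<open>W\<close>.\<close>
    define f' where "f' y = 1 - f y" for y
    have f': "continuous_map X euclideanreal f'"
      unfolding f'_def using f(1)
      by (intro continuous_map_diff continuous_map_const[THEN iffD2]) (auto simp: continuous_map_in_subtopology)
    then have "openin X {y \<in> topspace X. f' y \<in> - {0}}"
      by (rule openin_continuous_map_preimage) auto
    moreover have "x \<in> {y \<in> topspace X. f' y \<in> - {0}}"
      using \<open>x \<in> topspace X - _\<close> f(2) by (simp add: f'_def)
    \<comment> \<open>Shrinking the cozero set of \<open>f'\<close> to a base member
      \<open>V\<close> puts the pair \<open>(V, W)\<close> in \<open>B \<times> B\<close>. The
      selected \<open>F V W\<close> may differ from \<open>f'\<close>, but \<open>P\<close> still
      makes it nonzero at \<open>x\<close> and zero off \<open>W\<close>.\<close>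
    ultimately obtain V where V: "V \<in> B" "x \<in> V" "V \<subseteq> {y \<in> topspace X. f' y \<in> - {0}}"
      using B(3) by meson
    have "P V W f'"
      unfolding P_def using f' V(3) f(3) by (auto simp: f'_def image_subset_iff)
    from F[OF this] V W show ?thesis
      unfolding P_def \<F>_def by (intro bexI[of _ "F V W"]) auto
  qed
  have "countable \<F>" "\<F> \<noteq> {}"
    unfolding \<F>_def using B(1) by auto
  then have "range (from_nat_into \<F>) = \<F>"
    by (rule range_from_nat_into[rotated])
  then have \<F>: "f \<in> \<F> \<longleftrightarrow> (\<exists>n. f = from_nat_into \<F> n)" for f
    by auto
  show ?thesis
  proof (rule that)
    show "continuous_map X euclideanreal (from_nat_into \<F> n)" for n
      by (rule cont) (use \<F> in blast)
    show "\<exists>n. from_nat_into \<F> n x \<noteq> 0 \<and> {y \<in> topspace X. from_nat_into \<F> n y \<noteq> 0} \<subseteq> U"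
      if U: "openin X U" "x \<in> U" for U x
    proof -
      obtain f where f: "f \<in> \<F>" "f x \<noteq> 0 \<and> {y \<in> topspace X. f y \<noteq> 0} \<subseteq> U"
        using sep[OF U] by (rule bexE)
      then obtain n where "f = from_nat_into \<F> n" using \<F> by blast
      then show ?thesis using f(2) by blast
    qed
  qed
qed

text \<open>The family separates points: a function that is nonzero at \<open>x\<close> and
  supported in a neighbourhood missing \<open>y\<close> vanishes at \<open>y\<close>.\<close>

lemma Hausdorff_eqI:
  assumes "Hausdorff_space X" "x \<in> topspace X" "y \<in> topspace X"
    and "\<And>U x. openin X U \<Longrightarrow> x \<in> U \<Longrightarrow> \<exists>n. \<phi> n x \<noteq> (0::real) \<and> {y \<in> topspace X. \<phi> n y \<noteq> 0} \<subseteq> U"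
    and "\<And>n. \<phi> n x = \<phi> n y"
  shows "x = y"
proof (rule ccontr)
  assume "x \<noteq> y"
  then obtain U where U: "openin X U" "x \<in> U" "y \<notin> U"
    using assms(1-3) unfolding Hausdorff_space_def disjnt_iff by metis
  then obtain n where "\<phi> n x \<noteq> 0" "{y \<in> topspace X. \<phi> n y \<noteq> 0} \<subseteq> U"
    using assms(4) by blast
  then show False using U(3) assms(3,5) by auto
qed

text \<open>Every open set of \<open>X\<close> is a union of sets where some \<open>\<phi> n\<close>
  is nonzero, and the preimage of such a set under \<open>q\<close> is the cozero set of a
  continuous function on \<open>Y\<close>.\<close>

lemma continuous_map_if_real_compositions:
  assumes q: "\<And>x. x \<in> topspace Y \<Longrightarrow> q x \<in> topspace X"
    and cont: "\<And>n. continuous_map Y euclideanreal (\<lambda>x. \<phi> n (q x))"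
    and \<phi>: "\<And>U x. openin X U \<Longrightarrow> x \<in> U \<Longrightarrow> \<exists>n. \<phi> n x \<noteq> 0 \<and> {y \<in> topspace X. \<phi> n y \<noteq> 0} \<subseteq> U"
  shows "continuous_map Y X q"
  unfolding continuous_map_def
proof (intro conjI allI impI)
  fix U assume U: "openin X U"
  show "openin Y {x \<in> topspace Y. q x \<in> U}"
  proof (subst openin_subopen, clarify)
    fix x assume x: "x \<in> topspace Y" "q x \<in> U"
    obtain n where n: "\<phi> n (q x) \<noteq> 0" "{y \<in> topspace X. \<phi> n y \<noteq> 0} \<subseteq> U"
      using \<phi>[OF U x(2)] by blast
    have "openin Y {z \<in> topspace Y. \<phi> n (q z) \<in> - {0}}"
      by (rule openin_continuous_map_preimage[OF cont]) auto
    then show "\<exists>W. openin Y W \<and> x \<in> W \<and> W \<subseteq> {x \<in> topspace Y. q x \<in> U}"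
      using n x q by (intro exI[of _ "{z \<in> topspace Y. \<phi> n (q z) \<in> - {0}}"]) auto
  qed
qed (use q in auto)

section \<open>Products and subgroups of topological groups\<close>

lemma topological_group_DirProd:
  assumes "topological_group G S" "topological_group H T"
  shows "topological_group (G \<times>\<times> H) (prod_topology S T)"
proof -
  interpret G: topological_group G S by fact
  interpret H: topological_group H T by fact
  let ?P = "prod_topology S T"
  have f: "continuous_map (prod_topology ?P ?P) (prod_topology S S) (\<lambda>p. (fst (fst p), fst (snd p)))"
    using continuous_map_compose[OF continuous_map_fst[of ?P ?P] continuous_map_fst]
      continuous_map_compose[OF continuous_map_snd[of ?P ?P] continuous_map_fst]
    by (simp add: continuous_map_paired o_def)
  have s: "continuous_map (prod_topology ?P ?P) (prod_topology T T) (\<lambda>p. (snd (fst p), snd (snd p)))"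
    using continuous_map_compose[OF continuous_map_fst[of ?P ?P] continuous_map_snd]
      continuous_map_compose[OF continuous_map_snd[of ?P ?P] continuous_map_snd]
    by (simp add: continuous_map_paired o_def)
  have "continuous_map (prod_topology ?P ?P) ?P (\<lambda>(x, y). x \<otimes>\<^bsub>G \<times>\<times> H\<^esub> y)"
    using continuous_map_pairedI[OF continuous_map_compose[OF f G.continuous_mult]
        continuous_map_compose[OF s H.continuous_mult]]
    by (simp add: o_def case_prod_unfold mult_DirProd')
  moreover have "continuous_map ?P ?P (\<lambda>x. inv\<^bsub>G \<times>\<times> H\<^esub> x)"
    using continuous_map_pairedI[OF continuous_map_compose[OF continuous_map_fst G.continuous_inv]
        continuous_map_compose[OF continuous_map_snd H.continuous_inv]]
    by (rule continuous_map_eq)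
      (auto simp: G.topspace_eq_carrier H.topspace_eq_carrier)
  moreover have "Tychonoff_space ?P"
    using G.Tychonoff H.Tychonoff unfolding Tychonoff_space_def
    by (simp add: Hausdorff_space_prod_topology completely_regular_space_prod_topology)
  ultimately show ?thesis
    using DirProd_group[OF G.is_group H.is_group]
    by (simp add: topological_group_def topological_group_axioms_def G.topspace_eq_carrier
        H.topspace_eq_carrier)
qed

lemma topological_group_product_group:
  assumes "\<And>i. i \<in> I \<Longrightarrow> topological_group (G i) (T i)"
  shows "topological_group (product_group I G) (product_topology T I)"
proof -
  have grp: "group (G i)" and top: "topspace (T i) = carrier (G i)" and ty: "Tychonoff_space (T i)"
    and mult: "continuous_map (prod_topology (T i) (T i)) (T i) (\<lambda>(x, y). x \<otimes>\<^bsub>G i\<^esub> y)"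
    and inv: "continuous_map (T i) (T i) (\<lambda>x. inv\<^bsub>G i\<^esub> x)" if "i \<in> I" for i
    using assms[OF that] by (simp_all add: topological_group_def topological_group_axioms_def)
  let ?P = "product_topology T I"
  have carr: "topspace ?P = carrier (product_group I G)"
    using top by (auto simp: PiE_iff)
  have pr: "continuous_map (prod_topology ?P ?P) (prod_topology (T i) (T i)) (\<lambda>p. (fst p i, snd p i))"
    if "i \<in> I" for i
    using continuous_map_compose[OF continuous_map_fst continuous_map_product_projection[OF that]]
      continuous_map_compose[OF continuous_map_snd continuous_map_product_projection[OF that]]
    by (intro continuous_map_pairedI) (simp_all add: o_def)
  have "continuous_map (prod_topology ?P ?P) ?P (\<lambda>(x, y). x \<otimes>\<^bsub>product_group I G\<^esub> y)"
    using continuous_map_compose[OF pr mult]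
    by (auto simp: continuous_map_componentwise case_prod_unfold o_def)
  \<comment> \<open>The inverse of the product group is given by this coordinatewise formula on the
    carrier, so continuity is shown for the formula first and then transferred.\<close>
  moreover have "continuous_map ?P ?P (\<lambda>x. \<lambda>i\<in>I. inv\<^bsub>G i\<^esub> x i)"
    using continuous_map_compose[OF continuous_map_product_projection[of _ I T] inv]
    by (auto simp: continuous_map_componentwise o_def)
  then have "continuous_map ?P ?P (\<lambda>x. inv\<^bsub>product_group I G\<^esub> x)"
    by (rule continuous_map_eq) (use carr grp in simp)
  moreover have "Tychonoff_space ?P"
    using ty unfolding Tychonoff_space_def
    by (simp add: Hausdorff_space_product_topology completely_regular_space_product_topology)
  moreover have "group (product_group I G)"
    using grp by simp
  ultimately show ?thesis
    using carr by (simp add: topological_group_def topological_group_axioms_def)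
qed

text \<open>Serves to cut a countable product of groups down to the image of a diagonal
  homomorphism.\<close>

lemma (in topological_group) topological_group_subgroup:
  assumes A: "subgroup A G"
  shows "topological_group (G\<lparr>carrier := A\<rparr>) (subtopology T A)"
proof -
  let ?K = "G\<lparr>carrier := A\<rparr>" and ?U = "subtopology T A"
  have sub: "A \<subseteq> carrier G" using A subgroup.subset by blast
  have "continuous_map (prod_topology ?U ?U) T (\<lambda>(x, y). x \<otimes> y)"
    using continuous_map_from_subtopology[OF continuous_mult] by (simp add: prod_topology_subtopology
        subtopology_subtopology Times_Int_Times)
  then have "continuous_map (prod_topology ?U ?U) ?U (\<lambda>(x, y). x \<otimes>\<^bsub>?K\<^esub> y)"
    using A by (auto simp: continuous_map_in_subtopology subgroup.m_closed)
  moreover have "continuous_map ?U ?U (\<lambda>x. inv x)"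
    using continuous_map_from_subtopology[OF continuous_inv] A
    by (auto simp: continuous_map_in_subtopology subgroup.m_inv_closed)
  then have "continuous_map ?U ?U (\<lambda>x. inv\<^bsub>?K\<^esub> x)"
    by (rule continuous_map_eq) (simp add: m_inv_consistent[OF A])
  moreover have "Tychonoff_space ?U"
    using Tychonoff unfolding Tychonoff_space_def
    by (simp add: Hausdorff_space_subtopology completely_regular_space_subtopology)
  ultimately show ?thesis
    using subgroup.subgroup_is_group[OF A is_group] sub topspace_eq_carrier
    by (auto simp: topological_group_def topological_group_axioms_def)
qed

section \<open>Factorizations\<close>

text \<open>Lifts factorization from real functions to maps into \<open>X\<close>: if the diagonal
  homomorphism \<open>k\<close> agrees at two points, then so does every \<open>\<phi> n\<close>
  after \<open>p\<close>, hence \<open>p\<close> itself, and \<open>p\<close> descends to the image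
  of \<open>k\<close>. The carrier consists of sequences because that image lies in a countable
  product of groups of reals.\<close>

lemma R_factorizable_group_map:
  fixes G :: "('a, 'm) monoid_scheme"
  assumes tg: "topological_group G T" and "R_factorizable_group G T"
    and X: "second_countable X" "Tychonoff_space X" and p: "continuous_map T X p"
  obtains K :: "(nat \<Rightarrow> real) monoid" and U h q where
    "topological_group K U" "second_countable U" "h \<in> hom G K" "continuous_map T U h"
    "continuous_map U X q" "\<And>x. x \<in> topspace T \<Longrightarrow> p x = q (h x)"
proof -
  interpret topological_group G T by fact
  obtain \<phi> :: "nat \<Rightarrow> _ \<Rightarrow> real" where \<phi>: "\<And>n. continuous_map X euclideanreal (\<phi> n)"
    "\<And>U x. openin X U \<Longrightarrow> x \<in> U \<Longrightarrow> \<exists>n. \<phi> n x \<noteq> 0 \<and> {y \<in> topspace X. \<phi> n y \<noteq> 0} \<subseteq> U"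
    using second_countable_completely_regular_functions[OF X(1)] X(2)
    unfolding Tychonoff_space_def by blast
  have "\<exists>(K :: real monoid) U h g. topological_group K U \<and> second_countable U \<and> h \<in> hom G K \<and>
      continuous_map T U h \<and> continuous_map U euclideanreal g \<and>
      (\<forall>x\<in>topspace T. \<phi> n (p x) = g (h x))" for n
    using assms(2) continuous_map_compose[OF p \<phi>(1), of n]
    unfolding R_factorizable_group_def o_def by blast
  then obtain K :: "nat \<Rightarrow> real monoid" and U h g where K: "\<And>n. topological_group (K n) (U n)"
    "\<And>n. second_countable (U n)" and h: "\<And>n. h n \<in> hom G (K n)" "\<And>n. continuous_map T (U n) (h n)"
    and g: "\<And>n. continuous_map (U n) euclideanreal (g n)"
    "\<And>n x. x \<in> topspace T \<Longrightarrow> \<phi> n (p x) = g n (h n x)"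
    by metis
  define L where "L = product_group UNIV K"
  define V where "V = product_topology U UNIV"
  define k where "k x = (\<lambda>n. h n x)" for x
  interpret L: topological_group L V
    unfolding L_def V_def using K(1) by (rule topological_group_product_group)
  have k_hom: "k \<in> hom G L"
    using h(1) unfolding hom_def L_def k_def by (auto simp: PiE_iff)
  have k_cont: "continuous_map T V k"
    using h(2) unfolding V_def k_def by (simp add: continuous_map_componentwise_UNIV)
  \<comment> \<open>The map \<open>q\<close> is built from preimages under \<open>k\<close>, so the
    target group is the image of \<open>k\<close> instead of all of \<open>L\<close>.\<close>
  define A where "A = k ` carrier G"
  have A: "subgroup A L"
    unfolding A_def
    using group_hom.img_is_subgroup[of G L k] k_hom is_group L.is_group
    by (simp add: group_hom_def group_hom_axioms_def)
  define q where "q u = p (inv_into (carrier G) k u)" for u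
  have inv: "inv_into (carrier G) k u \<in> carrier G" "k (inv_into (carrier G) k u) = u"
    if "u \<in> A" for u
    using that unfolding A_def by (auto intro: inv_into_into f_inv_into_f)
  have pX: "p x \<in> topspace X" if "x \<in> carrier G" for x
    using p that topspace_eq_carrier unfolding continuous_map_def by auto
  \<comment> \<open>The right-hand side mentions no preimage: the functions \<open>\<phi> n\<close>
    cannot detect which one \<open>inv_into\<close> selected.\<close>
  have \<phi>q: "\<phi> n (q u) = g n (u n)" if "u \<in> A" for n u
    using g(2)[of "inv_into (carrier G) k u" n] inv[OF that] topspace_eq_carrier
    unfolding q_def k_def by (metis (no_types))
  have Atop: "topspace (subtopology V A) = A"
    using subgroup.subset[OF A] L.topspace_eq_carrier by auto
  \<comment> \<open>By \<open>\<phi>q\<close>, each \<open>\<phi> n\<close> after \<open>q\<close>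
    is the restriction to \<open>A\<close> of \<open>g n\<close> composed with the
    \<open>n\<close>-th projection, whence continuity despite the arbitrary choice in
    \<open>q\<close>.\<close>
  have q_cont: "continuous_map (subtopology V A) X q"
  proof (rule continuous_map_if_real_compositions[OF _ _ \<phi>(2)])
    show "q u \<in> topspace X" if "u \<in> topspace (subtopology V A)" for u
      using that Atop inv pX unfolding q_def by auto
    have "continuous_map V euclideanreal (\<lambda>u. g n (u n))" for n
      using continuous_map_compose[OF continuous_map_product_projection[of n UNIV U] g(1)]
      by (simp add: V_def o_def)
    then show "continuous_map (subtopology V A) euclideanreal (\<lambda>u. \<phi> n (q u))" for n
      by (intro continuous_map_eq[OF continuous_map_from_subtopology]) (auto simp: Atop \<phi>q)
  qed
  show ?thesis
  proof (rule that)
    show "topological_group (L\<lparr>carrier := A\<rparr>) (subtopology V A)"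
      using L.topological_group_subgroup[OF A] .
    show "second_countable (subtopology V A)"
      unfolding V_def using K(2)
      by (intro second_countable_subtopology second_countable_product_topology) auto
    show "k \<in> hom G (L\<lparr>carrier := A\<rparr>)"
      using k_hom by (auto simp: hom_def A_def)
    show "continuous_map T (subtopology V A) k"
      using k_cont by (auto simp: continuous_map_in_subtopology A_def topspace_eq_carrier)
    show "continuous_map (subtopology V A) X q" by fact
    show "p x = q (k x)" if x: "x \<in> topspace T" for x
    \<comment> \<open>The preimage of \<open>k x\<close> selected in \<open>q\<close> may differ
      from \<open>x\<close>, but both sides have the same value \<open>g n (h n x)\<close> under
      every \<open>\<phi> n\<close>.\<close>
    proof (rule Hausdorff_eqI[OF _ _ _ \<phi>(2)])
      have "k x \<in> A" using x by (simp add: A_def topspace_eq_carrier)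
      then show "\<phi> n (p x) = \<phi> n (q (k x))" for n
        using g(2)[OF x] by (simp add: \<phi>q k_def)
      show "q (k x) \<in> topspace X"
        using \<open>k x \<in> A\<close> inv pX unfolding q_def by auto
    qed (use X(2) x pX topspace_eq_carrier in \<open>auto simp: Tychonoff_space_def\<close>)
  qed
qed

text \<open>Extend \<open>f\<close> to the larger group as \<open>f \<circ> r\<close>, factor it
  there, and restrict the homomorphism along \<open>i\<close>; on \<open>H\<close> the extension
  agrees with \<open>f\<close> because \<open>r\<close> undoes \<open>i\<close>.\<close>

lemma R_factorizable_group_retract:
  assumes "R_factorizable_group G S"
    and i: "i \<in> hom H G" "continuous_map T S i"
    and r: "continuous_map S T r" "\<And>x. x \<in> topspace T \<Longrightarrow> r (i x) = x"
  shows "R_factorizable_group H T"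
  unfolding R_factorizable_group_def
proof (intro allI impI)
  fix f assume "continuous_map T euclideanreal f"
  then have "continuous_map S euclideanreal (f \<circ> r)"
    using r(1) continuous_map_compose by blast
  then obtain K :: "real monoid" and U h g where K: "topological_group K U" "second_countable U"
    and h: "h \<in> hom G K" "continuous_map S U h"
    and g: "continuous_map U euclideanreal g" "\<forall>x\<in>topspace S. (f \<circ> r) x = g (h x)"
    using assms(1) unfolding R_factorizable_group_def by blast
  have "f x = g ((h \<circ> i) x)" if "x \<in> topspace T" for x
    using that g(2) r(2) i(2) unfolding continuous_map_def by (metis PiE comp_apply)
  then show "\<exists>(K :: real monoid) U h g. topological_group K U \<and> second_countable U \<and>
      h \<in> hom H K \<and> continuous_map T U h \<and> continuous_map U euclideanreal g \<and>
      (\<forall>x\<in>topspace T. f x = g (h x))"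
    using K g(1) hom_compose[OF i(1) h(1)] continuous_map_compose[OF i(2) h(2)] by blast
qed

lemma R_factorizable_group_imp_product:
  assumes "topological_group G S" "topological_group H T"
    and "R_factorizable_group (G \<times>\<times> H) (prod_topology S T)"
  shows "R_factorizable_product S T"
  unfolding R_factorizable_product_def
proof (intro allI impI)
  interpret G: topological_group G S by fact
  interpret H: topological_group H T by fact
  fix f assume "continuous_map (prod_topology S T) euclideanreal f"
  then obtain K :: "real monoid" and U h g where K: "topological_group K U" "second_countable U"
    and h: "h \<in> hom (G \<times>\<times> H) K" "continuous_map (prod_topology S T) U h"
    and g: "continuous_map U euclideanreal g"
      "\<forall>x\<in>topspace (prod_topology S T). f x = g (h x)"
    using assms(3) unfolding R_factorizable_group_def by blast
  interpret K: topological_group K U by fact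
  define h1 h2 where "h1 = (\<lambda>x. h (x, \<one>\<^bsub>H\<^esub>))" and "h2 = (\<lambda>y. h (\<one>\<^bsub>G\<^esub>, y))"
  \<comment> \<open>The multiplication of \<open>K\<close> is absorbed into the outer function, so
    \<open>U\<close> itself can serve as both second-countable factors. Joint continuity of the
    multiplication makes \<open>m\<close> continuous.\<close>
  define m where "m = (\<lambda>(a, b). g (a \<otimes>\<^bsub>K\<^esub> b))"
  have "continuous_map S (prod_topology S T) (\<lambda>x. (x, \<one>\<^bsub>H\<^esub>))"
    "continuous_map T (prod_topology S T) (\<lambda>y. (\<one>\<^bsub>G\<^esub>, y))"
    by (simp_all add: continuous_map_paired G.topspace_eq_carrier H.topspace_eq_carrier)
  then have h12: "continuous_map S U h1" "continuous_map T U h2"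
    using continuous_map_compose[OF _ h(2)] unfolding h1_def h2_def o_def by blast+
  have m: "continuous_map (prod_topology U U) euclideanreal m"
    using continuous_map_compose[OF K.continuous_mult g(1)]
    by (simp add: m_def o_def case_prod_unfold)
  have "f (x, y) = m (h1 x, h2 y)" if "x \<in> topspace S" "y \<in> topspace T" for x y
  proof -
    have "h (x, y) = h1 x \<otimes>\<^bsub>K\<^esub> h2 y"
      using hom_mult[OF h(1), of "(x, \<one>\<^bsub>H\<^esub>)" "(\<one>\<^bsub>G\<^esub>, y)"] that
      by (simp add: h1_def h2_def G.topspace_eq_carrier H.topspace_eq_carrier)
    then show ?thesis using that g(2) by (simp add: m_def)
  qed
  then show "\<exists>(X' :: real topology) (Y' :: real topology) g1 g2 h.
           Tychonoff_space X' \<and> second_countable X' \<and>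
           Tychonoff_space Y' \<and> second_countable Y' \<and>
           continuous_map S X' g1 \<and> continuous_map T Y' g2 \<and>
           continuous_map (prod_topology X' Y') euclideanreal h \<and>
           (\<forall>x\<in>topspace S. \<forall>y\<in>topspace T. f (x, y) = h (g1 x, g2 y))"
    using K.Tychonoff K(2) h12 m by blast
qed

lemma R_factorizable_group_DirProd:
  fixes G :: "('a, 'm) monoid_scheme" and H :: "('b, 'n) monoid_scheme"
  assumes "topological_group G S" "topological_group H T"
    and "R_factorizable_group G S" "R_factorizable_group H T" "R_factorizable_product S T"
  shows "R_factorizable_group (G \<times>\<times> H) (prod_topology S T)"
\<comment> \<open>The group constructed here consists of pairs of real sequences; this rule
  transports it to a group of reals.\<close>
proof (rule R_factorizable_groupI)
  fix f assume "continuous_map (prod_topology S T) euclideanreal f"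
  then obtain X' :: "real topology" and Y' :: "real topology" and g1 g2 e where
    X': "Tychonoff_space X'" "second_countable X'" and Y': "Tychonoff_space Y'" "second_countable Y'"
    and g: "continuous_map S X' g1" "continuous_map T Y' g2"
    and e: "continuous_map (prod_topology X' Y') euclideanreal e"
    "\<forall>x\<in>topspace S. \<forall>y\<in>topspace T. f (x, y) = e (g1 x, g2 y)"
    using assms(5) unfolding R_factorizable_product_def by meson
  obtain K :: "(nat \<Rightarrow> real) monoid" and U h q where
    K: "topological_group K U" "second_countable U" and h: "h \<in> hom G K" "continuous_map S U h"
    and q: "continuous_map U X' q" "\<And>x. x \<in> topspace S \<Longrightarrow> g1 x = q (h x)"
    using R_factorizable_group_map[OF assms(1,3) X'(2,1) g(1)] by metis
  obtain L :: "(nat \<Rightarrow> real) monoid" and V k r where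
    L: "topological_group L V" "second_countable V" and k: "k \<in> hom H L" "continuous_map T V k"
    and r: "continuous_map V Y' r" "\<And>x. x \<in> topspace T \<Longrightarrow> g2 x = r (k x)"
    using R_factorizable_group_map[OF assms(2,4) Y'(2,1) g(2)] by metis
  define hk where "hk = (\<lambda>(x, y). (h x, k y))"
  \<comment> \<open>The factorization is \<open>f = (e \<circ> qr) \<circ> hk\<close>: only
    \<open>hk\<close> has to be a homomorphism, while \<open>qr\<close> carries the group product
    back to \<open>X'\<close> and \<open>Y'\<close>.\<close>
  define qr where "qr = (\<lambda>(u, v). (q u, r v))"
  have "hk \<in> hom (G \<times>\<times> H) (K \<times>\<times> L)"
    using h(1) k(1) unfolding hk_def hom_def by auto
  moreover have "continuous_map (prod_topology S T) (prod_topology U V) hk"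
    unfolding hk_def continuous_map_prod_top using h(2) k(2) by blast
  moreover have "continuous_map (prod_topology U V) (prod_topology X' Y') qr"
    unfolding qr_def continuous_map_prod_top using q(1) r(1) by blast
  then have "continuous_map (prod_topology U V) euclideanreal (e \<circ> qr)"
    using e(1) by (rule continuous_map_compose)
  moreover have "\<forall>z\<in>topspace (prod_topology S T). f z = (e \<circ> qr) (hk z)"
    using e(2) q(2) r(2) by (auto simp: hk_def qr_def)
  ultimately show "\<exists>(K :: ((nat \<Rightarrow> real) \<times> (nat \<Rightarrow> real)) monoid) U h g.
      topological_group K U \<and> second_countable U \<and> h \<in> hom (G \<times>\<times> H) K \<and>
      continuous_map (prod_topology S T) U h \<and> continuous_map U euclideanreal g \<and>
      (\<forall>x\<in>topspace (prod_topology S T). f x = g (h x))"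
    using topological_group_DirProd[OF K(1) L(1)] second_countable_prod_topology[OF K(2) L(2)]
    by blast
qed

theorem theorem3:
  fixes G :: "('a, 'm) monoid_scheme" and H :: "('b, 'n) monoid_scheme"
    and S :: "'a topology" and T :: "'b topology"
  assumes "topological_group G S" and "topological_group H T"
  shows "R_factorizable_group (G \<times>\<times> H) (prod_topology S T) \<longleftrightarrow>
           R_factorizable_group G S \<and> R_factorizable_group H T \<and> R_factorizable_product S T"
proof
  interpret G: topological_group G S by fact
  interpret H: topological_group H T by fact
  assume fac: "R_factorizable_group (G \<times>\<times> H) (prod_topology S T)"
  have "R_factorizable_group G S"
    \<comment> \<open>\<open>G\<close> is the slice over the unit of \<open>H\<close>, a retract of
      the product under \<open>fst\<close>.\<close>
    by (rule R_factorizable_group_retract[OF fac, of "\<lambda>x. (x, \<one>\<^bsub>H\<^esub>)" _ _ fst])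
      (auto simp: hom_def continuous_map_paired continuous_map_fst H.topspace_eq_carrier)
  moreover have "R_factorizable_group H T"
    by (rule R_factorizable_group_retract[OF fac, of "\<lambda>y. (\<one>\<^bsub>G\<^esub>, y)" _ _ snd])
      (auto simp: hom_def continuous_map_paired continuous_map_snd G.topspace_eq_carrier)
  ultimately show "R_factorizable_group G S \<and> R_factorizable_group H T \<and> R_factorizable_product S T"
    using R_factorizable_group_imp_product[OF assms fac] by blast
qed (use R_factorizable_group_DirProd[OF assms] in blast)

end
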